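(* The Set-Fmla order-preserving logic $\mathcal{PP}_{\leq}$ of the variety of perfect paradefinite algebras is fully self-extensional and non-protoalgebraic (hence non-algebraizable).
   Context: Formulas are built from a denumerable set of propositional variables with $\land,\lor$ (binary), $\sim,\circ$ (unary), $\top,\bot$ (nullary). A De Morgan algebra is a bounded distributive lattice with a unary operation $\sim$ satisfying ${\sim}{\sim}x\approx x$ and ${\sim}(x\land y)\approx{\sim}x\lor{\sim}y$. A perfect paradefinite algebra (PP-algebra) is a De Morgan algebra with an additional unary operation $\circ$ satisfying: $\circ\circ x\approx\top$; $\circ x\approx\circ{\sim}x$; $\circ\top\approx\top$; $x\land{\sim}x\land\circ x\approx\bot$; $\circ(x\land y)\approx(\circ x\lor\circ y)\land(\circ x\lor{\sim}y)\land(\circ y\lor{\sim}x)$. $\mathcal{PP}_{\leq}$ is the consequence relation with $\Phi\vdash\psi$ iff there is a finite $\Phi'\subseteq\Phi$ such that $\bigwedge\Phi'\approx\bigwedge\Phi'\land\psi$ is valid in all PP-algebras (with $\bigwedge\varnothing=\top$). Standard notions of abstract algebraic logic, for a logic $\vdash$ over a signature $\Sigma$. An $\vdash$-filter of a $\Sigma$-algebra $\mathbf A$ is an $F\subseteq A$ such that $\langle\mathbf A,F\rangle$ is a model of $\vdash$; $\mathrm{Fi}(\mathbf A)$ is the family of these. For a closure system $\mathcal C$ on $A$, the Tarski congruence $\tilde\Omega(\mathcal C)$ is the largest congruence $\theta$ of $\mathbf A$ compatible with all $F\in\mathcal C$ (i.e. $a\in F$ and $a\mathrel\theta b$ imply $b\in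 F$). $\langle\mathbf A,\mathcal C\rangle$ is a full generalized model of $\vdash$ if $\{F/\tilde\Omega(\mathcal C):F\in\mathcal C\}=\mathrm{Fi}(\mathbf A/\tilde\Omega(\mathcal C))$. The logic $\vdash$ is fully self-extensional if, for every full generalized model $\langle\mathbf A,\mathcal C\rangle$, the relation "$a$ and $b$ belong to exactly the same members of $\mathcal C$" is a congruence of $\mathbf A$. The logic $\vdash$ is protoalgebraic if there is a set $\Delta(x,y)$ of formulas in at most two variables with $\varnothing\vdash\delta(x,x)$ for all $\delta\in\Delta$ and $\{x\}\cup\Delta(x,y)\vdash y$. "Algebraizable" is meant in the usual (Blok–Pigozzi style) sense; every algebraizable logic is protoalgebraic. *)

theory Defs
  imports "HOL-Library.Countable_Set"
begin

section \<open>Formulas\<close>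

datatype fm =
    Var nat
  | Conj fm fm
  | Disj fm fm
  | Neg fm
  | Circ fm
  | Top
  | Bot

instance fm :: countable
  by countable_datatype

primrec vars :: "fm \<Rightarrow> nat set" where
  "vars (Var n) = {n}"
| "vars (Conj \<phi> \<psi>) = vars \<phi> \<union> vars \<psi>"
| "vars (Disj \<phi> \<psi>) = vars \<phi> \<union> vars \<psi>"
| "vars (Neg \<phi>) = vars \<phi>"
| "vars (Circ \<phi>) = vars \<phi>"
| "vars Top = {}"
| "vars Bot = {}"

primrec subst :: "(nat \<Rightarrow> fm) \<Rightarrow> fm \<Rightarrow> fm" where
  "subst \<sigma> (Var n) = \<sigma> n"
| "subst \<sigma> (Conj \<phi> \<psi>) = Conj (subst \<sigma> \<phi>) (subst \<sigma> \<psi>)"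
| "subst \<sigma> (Disj \<phi> \<psi>) = Disj (subst \<sigma> \<phi>) (subst \<sigma> \<psi>)"
| "subst \<sigma> (Neg \<phi>) = Neg (subst \<sigma> \<phi>)"
| "subst \<sigma> (Circ \<phi>) = Circ (subst \<sigma> \<phi>)"
| "subst \<sigma> Top = Top"
| "subst \<sigma> Bot = Bot"

text \<open>A formula in at most one (two) variables is one over \<open>Var 0\<close> (and \<open>Var 1\<close>);
  \<open>inst1 \<delta> \<alpha>\<close> is \<open>\<delta>(\<alpha>)\<close> and \<open>inst2 \<delta> \<alpha> \<beta>\<close> is \<open>\<delta>(\<alpha>, \<beta>)\<close>.\<close>

definition inst1 :: "fm \<Rightarrow> fm \<Rightarrow> fm" where
  "inst1 \<delta> \<alpha> = subst (\<lambda>_. \<alpha>) \<delta>"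

definition inst2 :: "fm \<Rightarrow> fm \<Rightarrow> fm \<Rightarrow> fm" where
  "inst2 \<delta> \<alpha> \<beta> = subst (\<lambda>n. if n = 0 then \<alpha> else \<beta>) \<delta>"


section \<open>Algebras of the signature\<close>

record 'a alg =
  carr :: "'a set"
  meet :: "'a \<Rightarrow> 'a \<Rightarrow> 'a"
  join :: "'a \<Rightarrow> 'a \<Rightarrow> 'a"
  neg :: "'a \<Rightarrow> 'a"
  circ :: "'a \<Rightarrow> 'a"
  tp :: 'a
  bt :: 'a

definition algebra :: "'a alg \<Rightarrow> bool" where
  "algebra A \<longleftrightarrow>
    (\<forall>x\<in>carr A. \<forall>y\<in>carr A. meet A x y \<in> carr A \<and> join A x y \<in> carr A) \<and>
    (\<forall>x\<in>carr A. neg A x \<in> carr A \<and> circ A x \<in> carr A) \<and>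
    tp A \<in> carr A \<and> bt A \<in> carr A"

definition valuation :: "'a alg \<Rightarrow> (nat \<Rightarrow> 'a) \<Rightarrow> bool" where
  "valuation A v \<longleftrightarrow> range v \<subseteq> carr A"

primrec eval :: "'a alg \<Rightarrow> (nat \<Rightarrow> 'a) \<Rightarrow> fm \<Rightarrow> 'a" where
  "eval A v (Var n) = v n"
| "eval A v (Conj \<phi> \<psi>) = meet A (eval A v \<phi>) (eval A v \<psi>)"
| "eval A v (Disj \<phi> \<psi>) = join A (eval A v \<phi>) (eval A v \<psi>)"
| "eval A v (Neg \<phi>) = neg A (eval A v \<phi>)"
| "eval A v (Circ \<phi>) = circ A (eval A v \<phi>)"
| "eval A v Top = tp A"
| "eval A v Bot = bt A"

definition satisfies_eq :: "'a alg \<Rightarrow> fm \<Rightarrow> fm \<Rightarrow> bool" where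
  "satisfies_eq A \<phi> \<psi> \<longleftrightarrow> (\<forall>v. valuation A v \<longrightarrow> eval A v \<phi> = eval A v \<psi>)"

definition bounded_distrib_lattice :: "'a alg \<Rightarrow> bool" where
  "bounded_distrib_lattice A \<longleftrightarrow> algebra A \<and>
    (\<forall>x\<in>carr A. \<forall>y\<in>carr A. meet A x y = meet A y x \<and> join A x y = join A y x) \<and>
    (\<forall>x\<in>carr A. \<forall>y\<in>carr A. \<forall>z\<in>carr A.
       meet A (meet A x y) z = meet A x (meet A y z) \<and>
       join A (join A x y) z = join A x (join A y z)) \<and>
    (\<forall>x\<in>carr A. \<forall>y\<in>carr A. meet A x (join A x y) = x \<and> join A x (meet A x y) = x) \<and>
    (\<forall>x\<in>carr A. \<forall>y\<in>carr A. \<forall>z\<in>carr A.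
       meet A x (join A y z) = join A (meet A x y) (meet A x z)) \<and>
    (\<forall>x\<in>carr A. meet A x (tp A) = x \<and> join A x (bt A) = x)"

definition de_morgan_algebra :: "'a alg \<Rightarrow> bool" where
  "de_morgan_algebra A \<longleftrightarrow> bounded_distrib_lattice A \<and>
    (\<forall>x\<in>carr A. neg A (neg A x) = x) \<and>
    (\<forall>x\<in>carr A. \<forall>y\<in>carr A. neg A (meet A x y) = join A (neg A x) (neg A y))"

definition pp_algebra :: "'a alg \<Rightarrow> bool" where
  "pp_algebra A \<longleftrightarrow> de_morgan_algebra A \<and>
    (\<forall>x\<in>carr A. circ A (circ A x) = tp A) \<and>
    (\<forall>x\<in>carr A. circ A x = circ A (neg A x)) \<and>
    circ A (tp A) = tp A \<and>
    (\<forall>x\<in>carr A. meet A (meet A x (neg A x)) (circ A x) = bt A) \<and>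
    (\<forall>x\<in>carr A. \<forall>y\<in>carr A.
       circ A (meet A x y) =
         meet A (meet A (join A (circ A x) (circ A y)) (join A (circ A x) (neg A y)))
                (join A (circ A y) (neg A x)))"


section \<open>The order-preserving logic of PP-algebras\<close>

text \<open>HOL cannot quantify over algebras of all types inside a definition, so validity is taken over
  the PP-algebras with carrier in a type \<open>'u\<close>. By \<open>pp_valid_transfer\<close> below, for
  every infinite \<open>'u\<close> this is validity in the PP-algebras of all types; in particular it does not
  depend on the choice of \<open>'u\<close> (\<open>pp_valid_iff_all\<close>).\<close>

definition pp_valid :: "'u itself \<Rightarrow> fm \<Rightarrow> fm \<Rightarrow> bool" where
  "pp_valid _ \<phi> \<psi> \<longleftrightarrow> (\<forall>A :: 'u alg. pp_algebra A \<longrightarrow> satisfies_eq A \<phi> \<psi>)"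

lemma eval_in_carr:
  assumes "algebra A" "valuation A v"
  shows "eval A v \<phi> \<in> carr A"
  using assms by (induction \<phi>) (auto simp: algebra_def valuation_def)

lemma pp_valid_transfer:
  fixes A :: "'a alg"
  assumes inf: "infinite (UNIV :: 'u set)"
    and valid: "pp_valid TYPE('u) \<phi> \<psi>"
    and pp: "pp_algebra A"
  shows "satisfies_eq A \<phi> \<psi>"
  unfolding satisfies_eq_def
proof (intro allI impI)
  fix v assume v: "valuation A v"
  define S where "S = range (eval A v)"
  have "countable S" by (simp add: S_def)
  obtain e :: "nat \<Rightarrow> 'u" where e: "inj e"
    using infinite_countable_subset[OF inf] by blast
  define g where "g = e \<circ> to_nat_on S"
  have g: "inj_on g S"
    unfolding g_def using \<open>countable S\<close> e
    by (meson comp_inj_on inj_on_subset inj_on_to_nat_on subset_UNIV)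
  define h where "h = inv_into S g"
  have hg: "h (g x) = x" if "x \<in> S" for x
    using that g by (simp add: h_def)
  define B :: "'u alg" where "B = \<lparr>carr = g ` S,
      meet = \<lambda>x y. g (meet A (h x) (h y)), join = \<lambda>x y. g (join A (h x) (h y)),
      neg = \<lambda>x. g (neg A (h x)), circ = \<lambda>x. g (circ A (h x)), tp = g (tp A), bt = g (bt A)\<rparr>"
  have alg: "algebra A"
    using pp by (simp add: pp_algebra_def de_morgan_algebra_def bounded_distrib_lattice_def)
  have S_carr: "x \<in> carr A" if "x \<in> S" for x
    using that eval_in_carr[OF alg v] by (auto simp: S_def)
  have eval_S: "eval A v c \<in> S" for c by (simp add: S_def)
  have ex_S: "\<exists>c. x = eval A v c" if "x \<in> S" for x using that by (auto simp: S_def)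
  have cl2: "meet A x y \<in> S" "join A x y \<in> S" if "x \<in> S" "y \<in> S" for x y
    using ex_S[OF that(1)] ex_S[OF that(2)] by (metis eval_S eval.simps(2), metis eval_S eval.simps(3))
  have cl1: "neg A x \<in> S" "circ A x \<in> S" if "x \<in> S" for x
    using ex_S[OF that] by (metis eval_S eval.simps(4), metis eval_S eval.simps(5))
  have cl0: "tp A \<in> S" "bt A \<in> S"
    by (metis eval_S eval.simps(6), metis eval_S eval.simps(7))
  note B_simps = B_def cl2 cl1 cl0 hg
  have "algebra B"
    unfolding algebra_def by (simp add: B_simps)
  moreover have bdl: "bounded_distrib_lattice A" and dm: "de_morgan_algebra A"
    using pp by (simp_all add: pp_algebra_def de_morgan_algebra_def)
  ultimately have "bounded_distrib_lattice B"
    using bdl unfolding bounded_distrib_lattice_def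
    by (intro conjI; simp add: B_simps; metis S_carr)
  then have dmB: "de_morgan_algebra B"
    using dm unfolding de_morgan_algebra_def
    by (intro conjI) (simp_all add: B_simps S_carr)
  note ppA = pp[unfolded pp_algebra_def]
  have "pp_algebra B"
    unfolding pp_algebra_def
    by (intro conjI, rule dmB) (simp add: B_simps; metis ppA S_carr)+
  moreover have "valuation B (g \<circ> v)"
  proof -
    have "v n \<in> S" for n using eval_S[of "Var n"] by simp
    then show ?thesis by (auto simp: valuation_def B_def)
  qed
  ultimately have "eval B (g \<circ> v) \<phi> = eval B (g \<circ> v) \<psi>"
    using valid by (auto simp: pp_valid_def satisfies_eq_def)
  moreover have "eval B (g \<circ> v) \<chi> = g (eval A v \<chi>)" for \<chi>
    by (induction \<chi>) (simp_all add: B_def hg eval_S)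
  ultimately show "eval A v \<phi> = eval A v \<psi>"
    using g by (simp add: S_def inj_on_def)
qed

lemma pp_valid_iff_all:
  assumes "infinite (UNIV :: 'u set)" "infinite (UNIV :: 'w set)"
  shows "pp_valid TYPE('u) \<phi> \<psi> \<longleftrightarrow> pp_valid TYPE('w) \<phi> \<psi>"
  using pp_valid_transfer[OF assms(1), where 'a = 'w] pp_valid_transfer[OF assms(2), where 'a = 'u]
  unfolding pp_valid_def by blast

text \<open>The finite set \<open>\<Phi>'\<close> of premises is given by an enumeration \<open>xs\<close>; the value of the
  conjunction in a PP-algebra depends on \<open>set xs\<close> only. The empty conjunction is \<open>Top\<close>.\<close>

definition big_conj :: "fm list \<Rightarrow> fm" where
  "big_conj xs = foldr Conj xs Top"

definition pp_le :: "'u itself \<Rightarrow> fm set \<Rightarrow> fm \<Rightarrow> bool" where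
  "pp_le U \<Phi> \<psi> \<longleftrightarrow>
    (\<exists>xs. set xs \<subseteq> \<Phi> \<and> pp_valid U (big_conj xs) (Conj (big_conj xs) \<psi>))"


section \<open>Abstract algebraic logic\<close>

definition is_filter :: "(fm set \<Rightarrow> fm \<Rightarrow> bool) \<Rightarrow> 'a alg \<Rightarrow> 'a set \<Rightarrow> bool" where
  "is_filter L A F \<longleftrightarrow> F \<subseteq> carr A \<and>
    (\<forall>\<Phi> \<psi> v. L \<Phi> \<psi> \<longrightarrow> valuation A v \<longrightarrow> eval A v ` \<Phi> \<subseteq> F \<longrightarrow> eval A v \<psi> \<in> F)"

definition Fi :: "(fm set \<Rightarrow> fm \<Rightarrow> bool) \<Rightarrow> 'a alg \<Rightarrow> 'a set set" where
  "Fi L A = {F. is_filter L A F}"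

definition closure_system :: "'a set \<Rightarrow> 'a set set \<Rightarrow> bool" where
  "closure_system X C \<longleftrightarrow> C \<subseteq> Pow X \<and> X \<in> C \<and> (\<forall>D. D \<subseteq> C \<longrightarrow> D \<noteq> {} \<longrightarrow> \<Inter>D \<in> C)"

definition congruence :: "'a alg \<Rightarrow> ('a \<times> 'a) set \<Rightarrow> bool" where
  "congruence A \<theta> \<longleftrightarrow> equiv (carr A) \<theta> \<and>
    (\<forall>(x, x')\<in>\<theta>. \<forall>(y, y')\<in>\<theta>.
       (meet A x y, meet A x' y') \<in> \<theta> \<and> (join A x y, join A x' y') \<in> \<theta>) \<and>
    (\<forall>(x, x')\<in>\<theta>. (neg A x, neg A x') \<in> \<theta> \<and> (circ A x, circ A x') \<in> \<theta>)"

definition compatible :: "('a \<times> 'a) set \<Rightarrow> 'a set \<Rightarrow> bool" where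
  "compatible \<theta> F \<longleftrightarrow> (\<forall>a b. a \<in> F \<longrightarrow> (a, b) \<in> \<theta> \<longrightarrow> b \<in> F)"

definition tarski_congruence :: "'a alg \<Rightarrow> 'a set set \<Rightarrow> ('a \<times> 'a) set" where
  "tarski_congruence A C = (GREATEST \<theta>. congruence A \<theta> \<and> (\<forall>F\<in>C. compatible \<theta> F))"

definition quotient_alg :: "'a alg \<Rightarrow> ('a \<times> 'a) set \<Rightarrow> 'a set alg" where
  "quotient_alg A \<theta> = \<lparr>carr = carr A // \<theta>,
     meet = \<lambda>X Y. \<Union>x\<in>X. \<Union>y\<in>Y. \<theta> `` {meet A x y},
     join = \<lambda>X Y. \<Union>x\<in>X. \<Union>y\<in>Y. \<theta> `` {join A x y},
     neg = \<lambda>X. \<Union>x\<in>X. \<theta> `` {neg A x},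
     circ = \<lambda>X. \<Union>x\<in>X. \<theta> `` {circ A x},
     tp = \<theta> `` {tp A},
     bt = \<theta> `` {bt A}\<rparr>"

text \<open>The GREATEST above is attained, so \<open>tarski_congruence A C\<close> is indeed the largest congruence
  compatible with all members of \<open>C\<close>.\<close>

lemma tarski_congruence_greatest:
  assumes alg: "algebra A"
  shows "congruence A (tarski_congruence A C)"
    and "F \<in> C \<Longrightarrow> compatible (tarski_congruence A C) F"
    and "congruence A \<theta> \<Longrightarrow> \<forall>F\<in>C. compatible \<theta> F \<Longrightarrow> \<theta> \<subseteq> tarski_congruence A C"
proof -
  let ?P = "\<lambda>\<theta>. congruence A \<theta> \<and> (\<forall>F\<in>C. compatible \<theta> F)"
  define R where "R = \<Union>{\<theta>. ?P \<theta>}"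
  have R_carr: "R \<subseteq> carr A \<times> carr A"
    by (auto simp: R_def congruence_def equiv_def)
  have Id: "?P (Id_on (carr A))"
    using alg
    by (auto simp: congruence_def equiv_def refl_on_def sym_def trans_def compatible_def algebra_def)
  have R_refl: "(x, x) \<in> R" if "x \<in> carr A" for x
    using Id that unfolding R_def by blast
  have R_sym: "(y, x) \<in> R" if "(x, y) \<in> R" for x y
    using that unfolding R_def congruence_def equiv_def sym_def by blast
  have T_carr: "R\<^sup>+ \<subseteq> carr A \<times> carr A"
    using R_carr by (rule trancl_subset_Sigma)
  have "sym R" using R_sym by (auto simp: sym_def)
  have equiv: "equiv (carr A) (R\<^sup>+)"
    using T_carr R_refl \<open>sym R\<close>
    by (auto simp: equiv_def refl_on_def sym_trancl)
  have lift: "(f x, f y) \<in> R\<^sup>+"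
    if "(x, y) \<in> R\<^sup>+" and "\<And>x y. (x, y) \<in> R \<Longrightarrow> (f x, f y) \<in> R" for f x y
    using that(1) by (induction rule: trancl_induct) (auto intro: that(2) trancl_into_trancl)
  have step: "(meet A x z, meet A y z) \<in> R" "(join A x z, join A y z) \<in> R"
    "(meet A z x, meet A z y) \<in> R" "(join A z x, join A z y) \<in> R"
    "(neg A x, neg A y) \<in> R" "(circ A x, circ A y) \<in> R"
    if xy: "(x, y) \<in> R" and z: "z \<in> carr A" for x y z
  proof -
    obtain \<theta> where \<theta>: "?P \<theta>" "(x, y) \<in> \<theta>" using xy by (auto simp: R_def)
    have zz: "(z, z) \<in> \<theta>" using \<theta>(1) z by (auto simp: congruence_def equiv_def refl_on_def)
    have "\<theta> \<subseteq> R" using \<theta>(1) by (auto simp: R_def)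
    then show "(meet A x z, meet A y z) \<in> R" "(join A x z, join A y z) \<in> R"
    "(meet A z x, meet A z y) \<in> R" "(join A z x, join A z y) \<in> R"
    "(neg A x, neg A y) \<in> R" "(circ A x, circ A y) \<in> R"
      using \<theta> zz unfolding congruence_def by blast+
  qed
  have binary: "(f x y, f x' y') \<in> R\<^sup>+"
    if xx: "(x, x') \<in> R\<^sup>+" and yy: "(y, y') \<in> R\<^sup>+"
      and s1: "\<And>x y z. (x, y) \<in> R \<Longrightarrow> z \<in> carr A \<Longrightarrow> (f x z, f y z) \<in> R"
      and s2: "\<And>x y z. (x, y) \<in> R \<Longrightarrow> z \<in> carr A \<Longrightarrow> (f z x, f z y) \<in> R" for f x x' y y'
  proof -
    have "y \<in> carr A" "x' \<in> carr A" using xx yy T_carr by auto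
    then have "(f x y, f x' y) \<in> R\<^sup>+" "(f x' y, f x' y') \<in> R\<^sup>+"
      using lift[OF xx, of "\<lambda>x. f x y"] lift[OF yy, of "f x'"] s1 s2 by auto
    then show ?thesis by (rule trancl_trans)
  qed
  have "congruence A (R\<^sup>+)"
    unfolding congruence_def
  proof (intro conjI ballI, safe)
    fix x x' y y' assume "(x, x') \<in> R\<^sup>+" "(y, y') \<in> R\<^sup>+"
    then show "(meet A x y, meet A x' y') \<in> R\<^sup>+" "(join A x y, join A x' y') \<in> R\<^sup>+"
      using binary step by blast+
  next
    fix x x' assume xx: "(x, x') \<in> R\<^sup>+"
    have tp: "tp A \<in> carr A" using alg by (simp add: algebra_def)
    show "(neg A x, neg A x') \<in> R\<^sup>+" "(circ A x, circ A x') \<in> R\<^sup>+"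
      using lift[OF xx] step(5,6)[OF _ tp] by blast+
  qed (use equiv in auto)
  moreover have "\<forall>F\<in>C. compatible (R\<^sup>+) F"
  proof
    fix F assume F: "F \<in> C"
    have "b \<in> F" if "(a, b) \<in> R\<^sup>+" "a \<in> F" for a b
      using that
    proof (induction rule: trancl_induct)
      case (base y)
      then show ?case using F unfolding R_def compatible_def by blast
    next
      case (step y z)
      then show ?case using F unfolding R_def compatible_def by blast
    qed
    then show "compatible (R\<^sup>+) F" by (auto simp: compatible_def)
  qed
  ultimately have P: "?P (R\<^sup>+)" by blast
  have ub: "\<theta> \<subseteq> R\<^sup>+" if "?P \<theta>" for \<theta>
    using that r_into_trancl[of _ R] unfolding R_def by fast
  have eq: "tarski_congruence A C = R\<^sup>+"
    unfolding tarski_congruence_def by (rule Greatest_equality) (use P ub in auto)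
  show "congruence A (tarski_congruence A C)"
    and "F \<in> C \<Longrightarrow> compatible (tarski_congruence A C) F"
    and "congruence A \<theta> \<Longrightarrow> \<forall>F\<in>C. compatible \<theta> F \<Longrightarrow> \<theta> \<subseteq> tarski_congruence A C"
    using P ub by (auto simp: eq)
qed

definition full_gmodel :: "(fm set \<Rightarrow> fm \<Rightarrow> bool) \<Rightarrow> 'a alg \<Rightarrow> 'a set set \<Rightarrow> bool" where
  "full_gmodel L A C \<longleftrightarrow> algebra A \<and> closure_system (carr A) C \<and>
    (\<lambda>F. F // tarski_congruence A C) ` C = Fi L (quotient_alg A (tarski_congruence A C))"

definition frege_relation :: "'a alg \<Rightarrow> 'a set set \<Rightarrow> ('a \<times> 'a) set" where
  "frege_relation A C = {(a, b). a \<in> carr A \<and> b \<in> carr A \<and> (\<forall>F\<in>C. a \<in> F \<longleftrightarrow> b \<in> F)}"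

text \<open>The type argument is the type of the elements of the algebras \<open>A\<close>; a statement about all
  algebras leaves it a free type variable.\<close>

definition fully_selfextensional :: "'a itself \<Rightarrow> (fm set \<Rightarrow> fm \<Rightarrow> bool) \<Rightarrow> bool" where
  "fully_selfextensional _ L \<longleftrightarrow>
    (\<forall>(A :: 'a alg) C. full_gmodel L A C \<longrightarrow> congruence A (frege_relation A C))"

definition protoalgebraic :: "(fm set \<Rightarrow> fm \<Rightarrow> bool) \<Rightarrow> bool" where
  "protoalgebraic L \<longleftrightarrow>
    (\<exists>\<Delta>. (\<forall>\<delta>\<in>\<Delta>. vars \<delta> \<subseteq> {0, 1} \<and> L {} (inst2 \<delta> (Var 0) (Var 0))) \<and>
         L ({Var 0} \<union> (\<lambda>\<delta>. inst2 \<delta> (Var 0) (Var 1)) ` \<Delta>) (Var 1))"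

text \<open>Equations are pairs of formulas; \<open>eq_conseq K\<close> is the equational consequence
  relative to the class \<open>K\<close>.\<close>

definition eq_conseq :: "'k alg set \<Rightarrow> (fm \<times> fm) set \<Rightarrow> fm \<times> fm \<Rightarrow> bool" where
  "eq_conseq K E e \<longleftrightarrow>
    (\<forall>A\<in>K. \<forall>v. valuation A v \<longrightarrow> (\<forall>(\<alpha>, \<beta>)\<in>E. eval A v \<alpha> = eval A v \<beta>) \<longrightarrow>
       eval A v (fst e) = eval A v (snd e))"

definition eqs_of :: "(fm \<times> fm) set \<Rightarrow> fm \<Rightarrow> (fm \<times> fm) set" where
  "eqs_of \<tau> \<phi> = (\<lambda>(\<alpha>, \<beta>). (inst1 \<alpha> \<phi>, inst1 \<beta> \<phi>)) ` \<tau>"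

text \<open>Algebraizability in its widest form: \<open>K\<close> is an arbitrary class of algebras, and the defining
  equations \<open>\<tau>(x)\<close> and the equivalence formulas \<open>\<Delta>(x, y)\<close> may be infinite sets. Blok and Pigozzi's
  original notion (\<open>\<tau>\<close>, \<open>\<Delta>\<close> finite and \<open>K\<close> a quasivariety) is a special case.\<close>

definition algebraizable :: "'k itself \<Rightarrow> (fm set \<Rightarrow> fm \<Rightarrow> bool) \<Rightarrow> bool" where
  "algebraizable _ L \<longleftrightarrow>
    (\<exists>(K :: 'k alg set) \<tau> \<Delta>.
       (\<forall>A\<in>K. algebra A) \<and>
       (\<forall>(\<alpha>, \<beta>)\<in>\<tau>. vars \<alpha> \<union> vars \<beta> \<subseteq> {0}) \<and>
       (\<forall>\<delta>\<in>\<Delta>. vars \<delta> \<subseteq> {0, 1}) \<and>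
       (\<forall>\<Gamma> \<phi>. L \<Gamma> \<phi> \<longleftrightarrow> (\<forall>e\<in>eqs_of \<tau> \<phi>. eq_conseq K (\<Union>\<gamma>\<in>\<Gamma>. eqs_of \<tau> \<gamma>) e)) \<and>
       (let E = (\<Union>\<delta>\<in>\<Delta>. eqs_of \<tau> (inst2 \<delta> (Var 0) (Var 1)))
        in (\<forall>e\<in>E. eq_conseq K {(Var 0, Var 1)} e) \<and> eq_conseq K E (Var 0, Var 1)))"

end

theory Submission
  imports Defs
begin

text \<open>
  \<^bold>\<open>Full self-extensionality.\<close>
  Let \<open>C\<close> be the family of filters of a full generalized model on \<open>A\<close>, and let \<open>\<theta>\<close> be its Tarski
  congruence. Elements related by \<open>\<theta>\<close> lie in the same members of \<open>C\<close>; the point is the converse.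
  If an equation \<open>\<phi> \<approx> \<psi>\<close> holds in all PP-algebras, then so does \<open>\<chi>(\<phi>) \<approx> \<chi>(\<psi>)\<close> for every context
  \<open>\<chi>\<close>, so \<open>\<chi>(\<phi>)\<close> and \<open>\<chi>(\<psi>)\<close> are interderivable, and no member of \<open>C\<close> can separate their values,
  because the members of \<open>C\<close> are filters of \<open>A\<close> (\<open>full_gmodel_filter\<close>).
  Since \<open>\<theta>\<close> relates two elements as soon as no member of \<open>C\<close> separates their images under a
  polynomial function (\<open>in_tarski_congruenceI\<close>), the values of \<open>\<phi>\<close> and \<open>\<psi>\<close> are \<open>\<theta>\<close>-related. Hence
  \<open>A/\<theta>\<close> satisfies all equations of PP-algebras and, as these form a variety
  (\<open>pp_algebra_iff_axioms\<close>), is itself a PP-algebra. In a PP-algebra the principal lattice filters are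
  filters of the logic (\<open>is_filter_principal\<close>), and they separate points. By fullness they all
  come from \<open>C\<close>, so \<open>C\<close> separates the \<open>\<theta>\<close>-classes: the Frege relation is \<open>\<theta>\<close>.

  \<^bold>\<open>Failure of protoalgebraicity.\<close>
  On the four-element chain \<open>0 < 1 < 2 < 3\<close>, where \<open>\<sim>\<close> reverses the order and \<open>\<circ>\<close> sends the two
  bounds to \<open>3\<close> and the two inner elements to \<open>0\<close>, identifying \<open>1\<close> with \<open>2\<close> is a congruence which
  leaves the top alone in its class. Let \<open>\<Delta>\<close> be a set of formulas with \<open>\<turnstile> \<delta>(x,x)\<close> for all \<open>\<delta>\<close> in it.
  Then \<open>\<delta>(2,2) = 3\<close>, hence \<open>\<delta>(2,1) = 3\<close>, so that the premises \<open>x\<close> and \<open>\<Delta>(x,y)\<close> have meet \<open>2\<close> at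
  \<open>x = 2\<close>, \<open>y = 1\<close>, and \<open>y\<close> does not follow from them.

  \<^bold>\<open>Failure of algebraizability.\<close>
  Equivalence formulas always witness protoalgebraicity.
\<close>

section \<open>Substitutions and quotients\<close>

lemma eval_subst: "eval A v (subst \<sigma> \<phi>) = eval A (\<lambda>n. eval A v (\<sigma> n)) \<phi>"
  by (induction \<phi>) simp_all

lemma eval_inst1: "eval A v (inst1 \<delta> \<alpha>) = eval A (\<lambda>_. eval A v \<alpha>) \<delta>"
  by (simp add: inst1_def eval_subst)

lemma eval_inst2:
  "eval A v (inst2 \<delta> \<alpha> \<beta>) = eval A (\<lambda>n. if n = 0 then eval A v \<alpha> else eval A v \<beta>) \<delta>"
  by (simp add: inst2_def eval_subst if_distrib[of "eval A v"] cong: if_cong)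

lemma eval_inst2_Var:
  "eval A v (inst2 \<delta> (Var i) (Var j)) = eval A (\<lambda>n. if n = 0 then v i else v j) \<delta>"
  by (simp add: eval_inst2 cong: if_cong)

lemma congruence_equiv: "congruence A \<theta> \<Longrightarrow> equiv (carr A) \<theta>"
  by (simp add: congruence_def)

lemma quotient_ops:
  assumes "congruence A \<theta>" "x \<in> carr A"
  shows "y \<in> carr A \<Longrightarrow> meet (quotient_alg A \<theta>) (\<theta> `` {x}) (\<theta> `` {y}) = \<theta> `` {meet A x y}"
    and "y \<in> carr A \<Longrightarrow> join (quotient_alg A \<theta>) (\<theta> `` {x}) (\<theta> `` {y}) = \<theta> `` {join A x y}"
    and "neg (quotient_alg A \<theta>) (\<theta> `` {x}) = \<theta> `` {neg A x}"
    and "circ (quotient_alg A \<theta>) (\<theta> `` {x}) = \<theta> `` {circ A x}"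
proof -
  note eq = congruence_equiv[OF assms(1)]
  have "congruent2 \<theta> \<theta> (\<lambda>x y. \<theta> `` {meet A x y})" "congruent2 \<theta> \<theta> (\<lambda>x y. \<theta> `` {join A x y})"
    using assms(1) unfolding congruent2_def congruence_def
    by (fastforce intro!: equiv_class_eq[OF eq])+
  then show "y \<in> carr A \<Longrightarrow> meet (quotient_alg A \<theta>) (\<theta> `` {x}) (\<theta> `` {y}) = \<theta> `` {meet A x y}"
    "y \<in> carr A \<Longrightarrow> join (quotient_alg A \<theta>) (\<theta> `` {x}) (\<theta> `` {y}) = \<theta> `` {join A x y}"
    by (simp_all add: quotient_alg_def UN_equiv_class2[OF eq eq _ assms(2)])
  have "congruent \<theta> (\<lambda>x. \<theta> `` {neg A x})" "congruent \<theta> (\<lambda>x. \<theta> `` {circ A x})"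
    using assms(1) unfolding congruent_def congruence_def
    by (fastforce intro!: equiv_class_eq[OF eq])+
  then show "neg (quotient_alg A \<theta>) (\<theta> `` {x}) = \<theta> `` {neg A x}"
    "circ (quotient_alg A \<theta>) (\<theta> `` {x}) = \<theta> `` {circ A x}"
    by (simp_all add: quotient_alg_def UN_equiv_class[OF eq _ assms(2)])
qed

lemma carr_quotient: "carr (quotient_alg A \<theta>) = carr A // \<theta>"
  by (simp add: quotient_alg_def)

lemma quotient_bounds:
  "tp (quotient_alg A \<theta>) = \<theta> `` {tp A}" "bt (quotient_alg A \<theta>) = \<theta> `` {bt A}"
  by (simp_all add: quotient_alg_def)

lemma algebra_quotient:
  assumes "algebra A" "congruence A \<theta>"
  shows "algebra (quotient_alg A \<theta>)"
  using assms(1)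
  by (auto simp: algebra_def carr_quotient quotient_ops[OF assms(2)] quotient_bounds
      elim!: quotientE intro!: quotientI)

lemma valuation_quotient:
  "valuation A v \<Longrightarrow> valuation (quotient_alg A \<theta>) (\<lambda>n. \<theta> `` {v n})"
  by (auto simp: valuation_def carr_quotient intro!: quotientI)

lemma valuation_quotientE:
  assumes "valuation (quotient_alg A \<theta>) w"
  obtains v where "valuation A v" "w = (\<lambda>n. \<theta> `` {v n})"
proof -
  have "\<exists>x. x \<in> carr A \<and> w n = \<theta> `` {x}" for n
    using assms by (auto simp: valuation_def carr_quotient elim!: quotientE dest!: range_subsetD)
  then obtain v where "\<And>n. v n \<in> carr A \<and> w n = \<theta> `` {v n}" by metis
  then show thesis by (intro that[of v]) (auto simp: valuation_def)
qed

lemma eval_quotient: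
  assumes "algebra A" "congruence A \<theta>" "valuation A v"
  shows "eval (quotient_alg A \<theta>) (\<lambda>n. \<theta> `` {v n}) \<phi> = \<theta> `` {eval A v \<phi>}"
  by (induction \<phi>)
     (simp_all add: quotient_ops[OF assms(2)] quotient_bounds eval_in_carr[OF assms(1,3)])

lemma class_in_quotient_iff:
  assumes "equiv X \<theta>" "compatible \<theta> F" "F \<subseteq> X" "a \<in> X"
  shows "\<theta> `` {a} \<in> F // \<theta> \<longleftrightarrow> a \<in> F"
proof
  assume "\<theta> `` {a} \<in> F // \<theta>"
  then obtain b where b: "b \<in> F" "\<theta> `` {a} = \<theta> `` {b}" by (auto elim: quotientE)
  then have "(b, a) \<in> \<theta>" using eq_equiv_class[OF _ assms(1,4)] by metis
  then show "a \<in> F" using assms(2) b(1) by (auto simp: compatible_def)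
qed (rule quotientI)


section \<open>Polynomial functions and the Tarski congruence\<close>

text \<open>This is the description of the Tarski congruence by polynomial functions: \<open>\<chi>\<close> denotes the unary
  polynomial function in its variable \<open>Var 0\<close>, with the values of \<open>v\<close> at the other variables as
  parameters.\<close>

definition poly_indist :: "'a alg \<Rightarrow> 'a set set \<Rightarrow> ('a \<times> 'a) set" where
  "poly_indist A C = {(a, b). a \<in> carr A \<and> b \<in> carr A \<and>
     (\<forall>\<chi> v. \<forall>F\<in>C. valuation A v \<longrightarrow> (eval A (v(0 := a)) \<chi> \<in> F \<longleftrightarrow> eval A (v(0 := b)) \<chi> \<in> F))}"

text \<open>Composing a polynomial function with the polynomial function of \<open>\<rho>\<close>, whose distinguished
  variable is \<open>Var 0\<close> and whose only parameter is \<open>Var 1\<close>, gives again a polynomial function: the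
  parameters of the former are shifted to make room for that of the latter.\<close>

lemma poly_indist_compose:
  assumes alg: "algebra A" and ab: "(a, b) \<in> poly_indist A C" and z: "z \<in> carr A"
  shows "(eval A (\<lambda>n. if n = 0 then a else z) \<rho>, eval A (\<lambda>n. if n = 0 then b else z) \<rho>)
    \<in> poly_indist A C"
proof -
  let ?e = "\<lambda>x. eval A (\<lambda>n. if n = 0 then x else z) \<rho>"
  have carr: "a \<in> carr A" "b \<in> carr A"
    and indist: "\<And>v F \<chi>. valuation A v \<Longrightarrow> F \<in> C \<Longrightarrow>
      eval A (v(0 := a)) \<chi> \<in> F \<longleftrightarrow> eval A (v(0 := b)) \<chi> \<in> F"
    using ab by (simp_all add: poly_indist_def)
  have "?e a \<in> carr A" "?e b \<in> carr A"
    using carr z by (auto intro!: eval_in_carr[OF alg] simp: valuation_def)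
  moreover have "eval A (v(0 := ?e a)) \<chi> \<in> F \<longleftrightarrow> eval A (v(0 := ?e b)) \<chi> \<in> F"
    if v: "valuation A v" and F: "F \<in> C" for \<chi> v F
  proof -
    define \<chi>' where "\<chi>' = subst (\<lambda>n. if n = 0 then inst2 \<rho> (Var 0) (Var 1) else Var (Suc n)) \<chi>"
    define v' where "v' = (\<lambda>n. if n = 1 then z else v (n - 1))"
    have v': "valuation A v'" using v z by (auto simp: v'_def valuation_def)
    have "eval A (v'(0 := x)) \<chi>' = eval A (v(0 := ?e x)) \<chi>" for x
    proof -
      have "eval A (v'(0 := x)) (inst2 \<rho> (Var 0) (Var 1)) = ?e x"
        by (simp add: eval_inst2_Var v'_def cong: if_cong)
      then have "(\<lambda>n. eval A (v'(0 := x)) (if n = 0 then inst2 \<rho> (Var 0) (Var 1) else Var (Suc n)))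
          = v(0 := ?e x)"
        by (auto simp: v'_def)
      then show ?thesis by (simp only: \<chi>'_def eval_subst)
    qed
    then show ?thesis using indist[OF v' F, of \<chi>'] by simp
  qed
  ultimately show ?thesis unfolding poly_indist_def by blast
qed

lemma congruence_poly_indist:
  assumes alg: "algebra A"
  shows "congruence A (poly_indist A C)"
proof -
  let ?R = "poly_indist A C"
  have eq: "equiv (carr A) ?R"
    by (auto simp: equiv_def refl_on_def sym_def trans_def poly_indist_def)
  have carr: "x \<in> carr A \<and> y \<in> carr A" if "(x, y) \<in> ?R" for x y
    using that by (auto simp: poly_indist_def)
  \<comment> \<open>The arguments of a binary operation are changed one at a time.\<close>
  have binary: "(eval A (\<lambda>n. if n = 0 then x else y) \<rho>, eval A (\<lambda>n. if n = 0 then x' else y') \<rho>) \<in> ?R"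
    if xx: "(x, x') \<in> ?R" and yy: "(y, y') \<in> ?R" for x x' y y' \<rho>
  proof -
    have flip: "eval A (\<lambda>n. if n = 0 then u else w) (inst2 \<rho> (Var 1) (Var 0))
        = eval A (\<lambda>n. if n = 0 then w else u) \<rho>" for u w
      by (simp add: eval_inst2_Var)
    have "(eval A (\<lambda>n. if n = 0 then x' else y) \<rho>, eval A (\<lambda>n. if n = 0 then x' else y') \<rho>) \<in> ?R"
      using poly_indist_compose[OF alg yy, of x' "inst2 \<rho> (Var 1) (Var 0)"] carr[OF xx]
      unfolding flip by blast
    moreover have "(eval A (\<lambda>n. if n = 0 then x else y) \<rho>, eval A (\<lambda>n. if n = 0 then x' else y) \<rho>) \<in> ?R"
      using poly_indist_compose[OF alg xx] carr[OF yy] by blast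
    moreover have "trans ?R" using eq by (simp add: equiv_def)
    ultimately show ?thesis by (blast dest: transD)
  qed
  have unary: "(eval A (\<lambda>n. if n = 0 then x else x) \<rho>, eval A (\<lambda>n. if n = 0 then x' else x') \<rho>) \<in> ?R"
    if "(x, x') \<in> ?R" for x x' \<rho>
    by (rule binary[OF that that])
  show ?thesis
    unfolding congruence_def
  proof (intro conjI ballI, rule eq, safe)
    fix x x' assume xx: "(x, x') \<in> ?R"
    show "(neg A x, neg A x') \<in> ?R" "(circ A x, circ A x') \<in> ?R"
      using unary[OF xx, of "Neg (Var 0)"] unary[OF xx, of "Circ (Var 0)"] by simp_all
    fix y y' assume yy: "(y, y') \<in> ?R"
    show "(meet A x y, meet A x' y') \<in> ?R" "(join A x y, join A x' y') \<in> ?R"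
      using binary[OF xx yy, of "Conj (Var 0) (Var 1)"] binary[OF xx yy, of "Disj (Var 0) (Var 1)"]
      by simp_all
  qed
qed

text \<open>The polynomially indistinguishable pairs form a congruence; it is compatible with the members
  of \<open>C\<close>, since the identity is a polynomial function, and therefore lies below the largest one.\<close>

lemma in_tarski_congruenceI:
  assumes alg: "algebra A" and "a \<in> carr A" "b \<in> carr A"
    and indist: "\<And>\<chi> v F. valuation A v \<Longrightarrow> F \<in> C \<Longrightarrow>
      eval A (v(0 := a)) \<chi> \<in> F \<longleftrightarrow> eval A (v(0 := b)) \<chi> \<in> F"
  shows "(a, b) \<in> tarski_congruence A C"
proof -
  have "compatible (poly_indist A C) F" if "F \<in> C" for F
    unfolding compatible_def
  proof (intro allI impI)
    fix x y assume x: "x \<in> F" and xy: "(x, y) \<in> poly_indist A C"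
    then have "x \<in> carr A" by (auto simp: poly_indist_def)
    then have "valuation A (\<lambda>_. x)" by (auto simp: valuation_def)
    then have "eval A ((\<lambda>_. x)(0 := x)) (Var 0) \<in> F \<longleftrightarrow> eval A ((\<lambda>_. x)(0 := y)) (Var 0) \<in> F"
      using xy that unfolding poly_indist_def by blast
    then show "y \<in> F" using x by simp
  qed
  then have "poly_indist A C \<subseteq> tarski_congruence A C"
    using tarski_congruence_greatest(3)[OF alg congruence_poly_indist[OF alg]] by blast
  moreover have "(a, b) \<in> poly_indist A C"
    using assms by (simp add: poly_indist_def)
  ultimately show ?thesis by blast
qed


section \<open>The variety of PP-algebras\<close>

definition pp_axioms :: "(fm \<times> fm) set" where
  "pp_axioms = (let x = Var 0; y = Var 1; z = Var 2 in
    {(Conj x y, Conj y x), (Disj x y, Disj y x),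
     (Conj (Conj x y) z, Conj x (Conj y z)), (Disj (Disj x y) z, Disj x (Disj y z)),
     (Conj x (Disj x y), x), (Disj x (Conj x y), x),
     (Conj x (Disj y z), Disj (Conj x y) (Conj x z)),
     (Conj x Top, x), (Disj x Bot, x),
     (Neg (Neg x), x), (Neg (Conj x y), Disj (Neg x) (Neg y)),
     (Circ (Circ x), Top), (Circ x, Circ (Neg x)), (Circ Top, Top),
     (Conj (Conj x (Neg x)) (Circ x), Bot),
     (Circ (Conj x y),
      Conj (Conj (Disj (Circ x) (Circ y)) (Disj (Circ x) (Neg y))) (Disj (Circ y) (Neg x)))})"

lemma pp_algebra_imp_de_morgan: "pp_algebra A \<Longrightarrow> de_morgan_algebra A"
  by (simp only: pp_algebra_def)

lemma pp_algebra_imp_algebra: "pp_algebra A \<Longrightarrow> algebra A"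
  by (simp only: pp_algebra_def de_morgan_algebra_def bounded_distrib_lattice_def)

text \<open>With the axioms as pairs of formulas, an algebra that inherits the valid equations of
  PP-algebras is recognized as a PP-algebra; this is how the quotient of a full generalized model
  becomes one.\<close>

lemma pp_algebra_iff_axioms:
  "pp_algebra A \<longleftrightarrow> algebra A \<and> (\<forall>(\<phi>, \<psi>)\<in>pp_axioms. satisfies_eq A \<phi> \<psi>)"
proof
  assume pp: "pp_algebra A"
  have "eval A v \<phi> = eval A v \<psi>" if "(\<phi>, \<psi>) \<in> pp_axioms" and v: "valuation A v" for \<phi> \<psi> v
  proof -
    have carr: "v n \<in> carr A" for n using v by (auto simp: valuation_def)
    note ax = pp[unfolded pp_algebra_def de_morgan_algebra_def bounded_distrib_lattice_def]
    note inst = bspec[OF _ carr[of 0]] bspec[OF _ carr[of "Suc 0"]] bspec[OF _ carr[of 2]]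
    \<comment> \<open>Each conjunct is one axiom, read at \<open>x = v 0\<close>, \<open>y = v 1\<close> and \<open>z = v 2\<close>.\<close>
    have "\<forall>(\<phi>, \<psi>)\<in>pp_axioms. eval A v \<phi> = eval A v \<psi>"
      by (simp (no_asm) add: pp_axioms_def Let_def, insert ax, elim conjE, intro conjI)
         (assumption
          | (drule inst(1), (drule inst(2), (drule inst(3))?)?, (elim conjE)?, assumption))+
    then show ?thesis using that(1) by blast
  qed
  then show "algebra A \<and> (\<forall>(\<phi>, \<psi>)\<in>pp_axioms. satisfies_eq A \<phi> \<psi>)"
    using pp_algebra_imp_algebra[OF pp] by (auto simp: satisfies_eq_def)
next
  assume ax: "algebra A \<and> (\<forall>(\<phi>, \<psi>)\<in>pp_axioms. satisfies_eq A \<phi> \<psi>)"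
  have *: "\<forall>(\<phi>, \<psi>)\<in>pp_axioms. eval A (\<lambda>n. if n = 0 then x else if n = 1 then y else z) \<phi>
      = eval A (\<lambda>n. if n = 0 then x else if n = 1 then y else z) \<psi>"
    if "x \<in> carr A" "y \<in> carr A" "z \<in> carr A" for x y z
  proof -
    have "valuation A (\<lambda>n. if n = 0 then x else if n = 1 then y else z)"
      using that by (auto simp: valuation_def)
    then show ?thesis using ax unfolding satisfies_eq_def by blast
  qed
  have tp: "tp A \<in> carr A" using ax by (simp add: algebra_def)
  note eqs = *[unfolded pp_axioms_def Let_def, simplified]
  show "pp_algebra A"
    unfolding pp_algebra_def de_morgan_algebra_def bounded_distrib_lattice_def
    using ax eqs tp by (intro conjI ballI) blast+
qed

lemma satisfies_eq_quotientI:
  assumes "algebra A" "congruence A \<theta>"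
    and "\<And>v. valuation A v \<Longrightarrow> (eval A v \<phi>, eval A v \<psi>) \<in> \<theta>"
  shows "satisfies_eq (quotient_alg A \<theta>) \<phi> \<psi>"
  unfolding satisfies_eq_def
proof (intro allI impI)
  fix w assume "valuation (quotient_alg A \<theta>) w"
  then obtain v where v: "valuation A v" "w = (\<lambda>n. \<theta> `` {v n})"
    by (rule valuation_quotientE)
  show "eval (quotient_alg A \<theta>) w \<phi> = eval (quotient_alg A \<theta>) w \<psi>"
    using equiv_class_eq[OF congruence_equiv[OF assms(2)] assms(3)[OF v(1)]]
    by (simp add: v(2) eval_quotient[OF assms(1,2) v(1)])
qed

lemma pp_algebraD:
  assumes "pp_algebra A"
  shows "algebra A" "tp A \<in> carr A"
    and "\<And>x y. x \<in> carr A \<Longrightarrow> y \<in> carr A \<Longrightarrow> meet A x y \<in> carr A"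
    and "\<And>x. x \<in> carr A \<Longrightarrow> meet A x (tp A) = x"
    and "\<And>x y. x \<in> carr A \<Longrightarrow> y \<in> carr A \<Longrightarrow> meet A x y = meet A y x"
  using pp_algebra_imp_de_morgan[OF assms]
  by (simp_all add: de_morgan_algebra_def bounded_distrib_lattice_def algebra_def)

lemma pp_meet_assoc:
  assumes "pp_algebra A" "x \<in> carr A" "y \<in> carr A" "z \<in> carr A"
  shows "meet A (meet A x y) z = meet A x (meet A y z)"
proof -
  have "\<forall>x\<in>carr A. \<forall>y\<in>carr A. \<forall>z\<in>carr A.
      meet A (meet A x y) z = meet A x (meet A y z) \<and> join A (join A x y) z = join A x (join A y z)"
    using pp_algebra_imp_de_morgan[OF assms(1), unfolded de_morgan_algebra_def bounded_distrib_lattice_def]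
    by - (elim conjE)
  then show ?thesis using assms(2-4) by blast
qed

lemma pp_meet_idem:
  assumes "pp_algebra A" "x \<in> carr A"
  shows "meet A x x = x"
proof -
  have absorb: "\<forall>x\<in>carr A. \<forall>y\<in>carr A. meet A x (join A x y) = x \<and> join A x (meet A x y) = x"
    using pp_algebra_imp_de_morgan[OF assms(1), unfolded de_morgan_algebra_def bounded_distrib_lattice_def]
    by - (elim conjE)
  have "meet A x x \<in> carr A" by (rule pp_algebraD(3)[OF assms assms(2)])
  then have "meet A x (join A x (meet A x x)) = x" "join A x (meet A x x) = x"
    using absorb assms(2) by blast+
  then show ?thesis by simp
qed

text \<open>Validity is preserved by substitutions (here \<open>\<tau>\<close>) and by putting both sides into a context
  (here \<open>\<chi>\<close> with its hole at \<open>Var 0\<close>). The separate substitution \<open>\<sigma>\<close> for the remaining variables of the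
  context keeps the parameters of a polynomial function apart from the variables of the equation.\<close>

lemma pp_valid_context:
  assumes "pp_valid U \<phi> \<psi>"
  shows "pp_valid U (subst (\<sigma>(0 := subst \<tau> \<phi>)) \<chi>) (subst (\<sigma>(0 := subst \<tau> \<psi>)) \<chi>)"
  unfolding pp_valid_def satisfies_eq_def
proof (intro allI impI)
  fix A :: "'a alg" and v
  assume A: "pp_algebra A" and v: "valuation A v"
  have "valuation A (\<lambda>n. eval A v (\<tau> n))"
    using eval_in_carr[OF pp_algebraD(1)[OF A] v] by (auto simp: valuation_def)
  then have "eval A v (subst \<tau> \<phi>) = eval A v (subst \<tau> \<psi>)"
    using assms A by (simp add: pp_valid_def satisfies_eq_def eval_subst)
  moreover have "(\<lambda>n. eval A v ((\<sigma>(0 := \<xi>)) n)) = (\<lambda>n. eval A v (\<sigma> n))(0 := eval A v \<xi>)" for \<xi>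
    by auto
  ultimately show "eval A v (subst (\<sigma>(0 := subst \<tau> \<phi>)) \<chi>) = eval A v (subst (\<sigma>(0 := subst \<tau> \<psi>)) \<chi>)"
    by (simp only: eval_subst[of A v "\<sigma>(0 := _)"])
qed


section \<open>Filters of the logic and full self-extensionality\<close>

lemma pp_valid_imp_pp_le:
  assumes "pp_valid U \<phi> \<psi>"
  shows "pp_le U {\<phi>} \<psi>" "pp_le U {\<psi>} \<phi>"
proof -
  have *: "pp_valid U (big_conj [\<xi>]) (Conj (big_conj [\<xi>]) \<xi>')"
    if "pp_valid U \<xi> \<xi>'" for \<xi> \<xi>'
    unfolding pp_valid_def satisfies_eq_def
  proof (intro allI impI)
    fix A :: "'a alg" and v
    assume A: "pp_algebra A" and v: "valuation A v"
    have "eval A v \<xi> = eval A v \<xi>'" using that A v by (simp add: pp_valid_def satisfies_eq_def)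
    moreover have "eval A v \<xi> \<in> carr A" by (rule eval_in_carr[OF pp_algebraD(1)[OF A] v])
    ultimately show "eval A v (big_conj [\<xi>]) = eval A v (Conj (big_conj [\<xi>]) \<xi>')"
      using pp_algebraD(4)[OF A] pp_meet_idem[OF A] by (simp add: big_conj_def)
  qed
  have "pp_valid U \<psi> \<phi>" using assms by (simp add: pp_valid_def satisfies_eq_def)
  then show "pp_le U {\<psi>} \<phi>"
    unfolding pp_le_def using * by (intro exI[of _ "[\<psi>]"]) simp
  show "pp_le U {\<phi>} \<psi>"
    unfolding pp_le_def using *[OF assms] by (intro exI[of _ "[\<phi>]"]) simp
qed

lemma is_filterD:
  "is_filter L A F \<Longrightarrow> L \<Phi> \<psi> \<Longrightarrow> valuation A v \<Longrightarrow> eval A v ` \<Phi> \<subseteq> F \<Longrightarrow> eval A v \<psi> \<in> F"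
  unfolding is_filter_def by blast

lemma filter_pp_valid_iff:
  assumes "is_filter (pp_le U) A F" "pp_valid U \<phi> \<psi>" "valuation A v"
  shows "eval A v \<phi> \<in> F \<longleftrightarrow> eval A v \<psi> \<in> F"
proof -
  have "\<And>\<phi> \<psi>. pp_le U {\<phi>} \<psi> \<Longrightarrow> eval A v \<phi> \<in> F \<Longrightarrow> eval A v \<psi> \<in> F"
    using is_filterD[OF assms(1) _ assms(3)] by simp
  then show ?thesis using pp_valid_imp_pp_le[OF assms(2)] by blast
qed

text \<open>An element below all premises is below their conjunction, which lies below the conclusion.
  As the logic is defined by the PP-algebras on \<open>'u\<close>, the last step needs \<open>'u\<close> to be infinite, so that
  the inequality holds in \<open>A\<close> as well.\<close>

lemma is_filter_principal:
  assumes inf: "infinite (UNIV :: 'u set)" and pp: "pp_algebra A" and a: "a \<in> carr A"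
  shows "is_filter (pp_le TYPE('u)) A {x \<in> carr A. meet A a x = a}" (is "is_filter _ A ?F")
  unfolding is_filter_def
proof (intro conjI allI impI)
  fix \<Phi> \<psi> v
  assume L: "pp_le TYPE('u) \<Phi> \<psi>" and v: "valuation A v" and \<Phi>: "eval A v ` \<Phi> \<subseteq> ?F"
  obtain xs where xs: "set xs \<subseteq> \<Phi>" "pp_valid TYPE('u) (big_conj xs) (Conj (big_conj xs) \<psi>)"
    using L by (auto simp: pp_le_def)
  note ev = eval_in_carr[OF pp_algebraD(1)[OF pp] v]
  have "set ys \<subseteq> \<Phi> \<Longrightarrow> meet A a (eval A v (big_conj ys)) = a" for ys
  proof (induction ys)
    case Nil
    show ?case using pp_algebraD(4)[OF pp a] by (simp add: big_conj_def)
  next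
    case (Cons \<phi> ys)
    then have "meet A a (eval A v \<phi>) = a" "meet A a (eval A v (big_conj ys)) = a" using \<Phi> by auto
    then show ?case
      using pp_meet_assoc[OF pp a ev[of \<phi>] ev[of "big_conj ys"]] by (simp add: big_conj_def)
  qed
  then have a_le: "meet A a (eval A v (big_conj xs)) = a" using xs(1) by blast
  have "eval A v (big_conj xs) = meet A (eval A v (big_conj xs)) (eval A v \<psi>)"
    using pp_valid_transfer[OF inf xs(2) pp] v by (simp add: satisfies_eq_def)
  then have "meet A a (eval A v \<psi>) = a"
    using pp_meet_assoc[OF pp a ev[of "big_conj xs"] ev[of \<psi>]] a_le by simp
  then show "eval A v \<psi> \<in> ?F" using ev by simp
qed auto

text \<open>The principal filters of \<open>a\<close> and \<open>b\<close> give \<open>a \<le> b\<close> and \<open>b \<le> a\<close>.\<close>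

lemma eq_if_same_filters:
  assumes inf: "infinite (UNIV :: 'u set)" and pp: "pp_algebra A" and ab: "a \<in> carr A" "b \<in> carr A"
    and same: "\<And>F. F \<in> Fi (pp_le TYPE('u)) A \<Longrightarrow> a \<in> F \<longleftrightarrow> b \<in> F"
  shows "a = b"
proof -
  have "meet A a b = a" "meet A b a = b"
    using same is_filter_principal[OF inf pp ab(1)] is_filter_principal[OF inf pp ab(2)] ab
      pp_meet_idem[OF pp]
    unfolding Fi_def by blast+
  then show ?thesis using pp_algebraD(5)[OF pp ab] by simp
qed

text \<open>By compatibility, \<open>F\<close> is the preimage of \<open>F/\<theta>\<close> under the projection to the quotient, where \<open>F/\<theta>\<close>
  is a filter by fullness; and preimages of filters under homomorphisms are filters.\<close>

lemma full_gmodel_filter: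
  assumes "full_gmodel L A C" "F \<in> C"
  shows "is_filter L A F"
  unfolding is_filter_def
proof (intro conjI allI impI)
  let ?\<theta> = "tarski_congruence A C"
  have alg: "algebra A" and sub: "C \<subseteq> Pow (carr A)"
    and Fi: "(\<lambda>F. F // ?\<theta>) ` C = Fi L (quotient_alg A ?\<theta>)"
    using assms(1) by (simp_all add: full_gmodel_def closure_system_def)
  have F: "F \<subseteq> carr A" using sub assms(2) by blast
  have Fq: "F // ?\<theta> \<in> Fi L (quotient_alg A ?\<theta>)"
    unfolding Fi[symmetric] using assms(2) by (rule imageI)
  note cong = tarski_congruence_greatest(1)[OF alg, of C]
  note mem = class_in_quotient_iff[OF congruence_equiv[OF cong]
      tarski_congruence_greatest(2)[OF alg assms(2)] F]
  show "F \<subseteq> carr A" by (fact F)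
  fix \<Phi> \<psi> v
  assume L: "L \<Phi> \<psi>" and v: "valuation A v" and \<Phi>: "eval A v ` \<Phi> \<subseteq> F"
  let ?w = "\<lambda>n. ?\<theta> `` {v n}"
  have iff: "eval (quotient_alg A ?\<theta>) ?w \<phi> \<in> F // ?\<theta> \<longleftrightarrow> eval A v \<phi> \<in> F" for \<phi>
    by (simp add: eval_quotient[OF alg cong v] mem eval_in_carr[OF alg v])
  then have "eval (quotient_alg A ?\<theta>) ?w ` \<Phi> \<subseteq> F // ?\<theta>" using \<Phi> by blast
  then have "eval (quotient_alg A ?\<theta>) ?w \<psi> \<in> F // ?\<theta>"
    using is_filterD[OF Fq[unfolded Fi_def mem_Collect_eq] L valuation_quotient[OF v]] by blast
  then show "eval A v \<psi> \<in> F" using iff by blast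
qed

text \<open>A polynomial function \<open>\<chi>\<close> applied to the values of \<open>\<phi>\<close> and \<open>\<psi>\<close> under \<open>v\<close>, with parameters from
  another valuation \<open>w\<close>, is a pair of values of \<open>\<chi>(\<phi>)\<close> and \<open>\<chi>(\<psi>)\<close> under a single valuation once the
  variables are made disjoint; here \<open>v\<close> is moved to the even variables and \<open>w\<close> to the odd ones.\<close>

lemma pp_valid_in_tarski_congruence:
  assumes full: "full_gmodel (pp_le U) A C" and valid: "pp_valid U \<phi> \<psi>" and v: "valuation A v"
  shows "(eval A v \<phi>, eval A v \<psi>) \<in> tarski_congruence A C"
proof -
  have alg: "algebra A" using full by (simp add: full_gmodel_def)
  show ?thesis
  proof (rule in_tarski_congruenceI[OF alg eval_in_carr[OF alg v] eval_in_carr[OF alg v]])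
    fix \<chi> w F
    assume w: "valuation A w" and F: "F \<in> C"
    define u where "u = (\<lambda>n. if even n then v (n div 2) else w (n div 2))"
    define \<tau> where "\<tau> n = Var (2 * n)" for n
    define \<sigma> where "\<sigma> n = Var (Suc (2 * n))" for n
    have u: "valuation A u" using v w by (auto simp: u_def valuation_def)
    have ev: "eval A u (subst (\<sigma>(0 := subst \<tau> \<xi>)) \<chi>) = eval A (w(0 := eval A v \<xi>)) \<chi>" for \<xi>
    proof -
      have "eval A u (subst \<tau> \<xi>) = eval A v \<xi>" by (simp add: eval_subst \<tau>_def u_def)
      then have "(\<lambda>n. eval A u ((\<sigma>(0 := subst \<tau> \<xi>)) n)) = w(0 := eval A v \<xi>)"
        by (auto simp: \<sigma>_def u_def)
      then show ?thesis by (simp only: eval_subst[of A u "\<sigma>(0 := _)"])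
    qed
    show "eval A (w(0 := eval A v \<phi>)) \<chi> \<in> F \<longleftrightarrow> eval A (w(0 := eval A v \<psi>)) \<chi> \<in> F"
      using filter_pp_valid_iff[OF full_gmodel_filter[OF full F]
          pp_valid_context[OF valid, of \<sigma> \<tau> \<chi>] u]
      unfolding ev .
  qed
qed

lemma pp_algebra_tarski_quotient:
  assumes "full_gmodel (pp_le TYPE('u)) A C"
  shows "pp_algebra (quotient_alg A (tarski_congruence A C))"
proof -
  have alg: "algebra A" using assms by (simp add: full_gmodel_def)
  note cong = tarski_congruence_greatest(1)[OF alg, of C]
  have "pp_valid TYPE('u) \<phi> \<psi>" if "(\<phi>, \<psi>) \<in> pp_axioms" for \<phi> \<psi>
    using that unfolding pp_valid_def pp_algebra_iff_axioms by blast
  then have "\<forall>(\<phi>, \<psi>)\<in>pp_axioms. satisfies_eq (quotient_alg A (tarski_congruence A C)) \<phi> \<psi>"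
    using satisfies_eq_quotientI[OF alg cong] pp_valid_in_tarski_congruence[OF assms] by blast
  then show ?thesis
    using algebra_quotient[OF alg cong] by (simp add: pp_algebra_iff_axioms)
qed

text \<open>The logic sees a full generalized model through the PP-algebra \<open>A/\<theta>\<close>, whose filters all come
  from \<open>C\<close> and separate points. Hence elements of \<open>A\<close> that \<open>C\<close> does not separate have the same
  \<open>\<theta>\<close>-class.\<close>

lemma frege_relation_eq_tarski:
  assumes inf: "infinite (UNIV :: 'u set)" and full: "full_gmodel (pp_le TYPE('u)) A C"
  shows "frege_relation A C = tarski_congruence A C" (is "_ = ?\<theta>")
proof -
  have alg: "algebra A" and C: "\<And>F. F \<in> C \<Longrightarrow> F \<subseteq> carr A"
    and Fi: "Fi (pp_le TYPE('u)) (quotient_alg A ?\<theta>) = (\<lambda>F. F // ?\<theta>) ` C"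
    using full by (auto simp: full_gmodel_def closure_system_def)
  note comp = tarski_congruence_greatest(2)[OF alg]
  note eq = congruence_equiv[OF tarski_congruence_greatest(1)[OF alg, of C]]
  have "(a, b) \<in> ?\<theta>" if "(a, b) \<in> frege_relation A C" for a b
  proof -
    have ab: "a \<in> carr A" "b \<in> carr A" "\<And>F. F \<in> C \<Longrightarrow> a \<in> F \<longleftrightarrow> b \<in> F"
      using that by (auto simp: frege_relation_def)
    have "?\<theta> `` {a} = ?\<theta> `` {b}"
    proof (rule eq_if_same_filters[OF inf pp_algebra_tarski_quotient[OF full]])
      show "?\<theta> `` {a} \<in> carr (quotient_alg A ?\<theta>)" "?\<theta> `` {b} \<in> carr (quotient_alg A ?\<theta>)"
        using ab by (auto simp: carr_quotient intro: quotientI)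
      show "?\<theta> `` {a} \<in> G \<longleftrightarrow> ?\<theta> `` {b} \<in> G"
        if "G \<in> Fi (pp_le TYPE('u)) (quotient_alg A ?\<theta>)" for G
        using that ab class_in_quotient_iff[OF eq comp C] by (auto simp: Fi)
    qed
    then show ?thesis using eq_equiv_class[OF _ eq ab(2)] by blast
  qed
  moreover have "(a, b) \<in> frege_relation A C" if "(a, b) \<in> ?\<theta>" for a b
  proof -
    have "a \<in> carr A" "b \<in> carr A" "(b, a) \<in> ?\<theta>"
      using that eq by (auto simp: equiv_def sym_def)
    then show ?thesis
      using that comp by (auto simp: frege_relation_def compatible_def)
  qed
  ultimately show ?thesis by auto
qed


section \<open>Failure of protoalgebraicity\<close>

text \<open>Two inner elements are needed: they have to be identified by a congruence that respects the
  filter \<open>{3}\<close>, and yet be separated by the larger filter \<open>{2, 3}\<close>.\<close>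

definition chain4 :: "nat alg" where
  "chain4 = \<lparr>carr = {0, 1, 2, 3}, meet = min, join = max, neg = (\<lambda>x. 3 - x),
     circ = (\<lambda>x. if x = 0 \<or> x = 3 then 3 else 0), tp = 3, bt = 0\<rparr>"

lemma chain4_simps [simp]:
  "carr chain4 = {0, 1, 2, 3}" "meet chain4 = min" "join chain4 = max" "neg chain4 x = 3 - x"
  "circ chain4 x = (if x = 0 \<or> x = 3 then 3 else 0)" "tp chain4 = 3" "bt chain4 = 0"
  by (simp_all add: chain4_def)

lemma pp_algebra_chain4: "pp_algebra chain4"
  unfolding pp_algebra_def de_morgan_algebra_def bounded_distrib_lattice_def algebra_def
  by simp

definition merge_inner :: "nat \<Rightarrow> nat" where
  "merge_inner x = (if x = 2 then 1 else x)"

text \<open>The kernel of \<open>merge_inner\<close> is a congruence of the chain: \<open>merge_inner\<close> is monotone and so preserves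
  minima and maxima, \<open>\<sim>\<close> maps the inner elements to inner elements, and \<open>\<circ>\<close> is constant on them.\<close>

lemma merge_inner_eval_cong:
  assumes "valuation chain4 v" "valuation chain4 w"
    and "\<And>n. merge_inner (v n) = merge_inner (w n)"
  shows "merge_inner (eval chain4 v \<phi>) = merge_inner (eval chain4 w \<phi>)"
proof (induction \<phi>)
  case (Conj \<phi> \<psi>)
  have "merge_inner (min x y) = min (merge_inner x) (merge_inner y)" for x y
    by (auto simp: merge_inner_def min_def)
  then show ?case using Conj by simp
next
  case (Disj \<phi> \<psi>)
  have "merge_inner (max x y) = max (merge_inner x) (merge_inner y)" for x y
    by (auto simp: merge_inner_def max_def)
  then show ?case using Disj by simp
next
  case (Neg \<phi>)
  have "eval chain4 u \<phi> \<in> {0, 1, 2, 3}" if "valuation chain4 u" for u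
    using eval_in_carr[OF pp_algebraD(1)[OF pp_algebra_chain4] that, of \<phi>] by simp
  from this[OF assms(1)] this[OF assms(2)] show ?case
    using Neg by (auto simp: merge_inner_def)
next
  case (Circ \<phi>)
  then show ?case by (simp add: merge_inner_def split: if_splits)
qed (simp_all add: assms(3))

text \<open>In a protoalgebraic logic a congruence compatible with a filter is compatible with every
  larger filter. The identification of \<open>1\<close> and \<open>2\<close> violates this for the filters \<open>{3}\<close> and \<open>{2, 3}\<close>.\<close>

lemma not_protoalgebraic:
  assumes inf: "infinite (UNIV :: 'u set)"
  shows "\<not> protoalgebraic (pp_le TYPE('u))"
proof
  assume "protoalgebraic (pp_le TYPE('u))"
  then obtain \<Delta> where refl: "\<And>\<delta>. \<delta> \<in> \<Delta> \<Longrightarrow> pp_le TYPE('u) {} (inst2 \<delta> (Var 0) (Var 0))"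
    and mp: "pp_le TYPE('u) ({Var 0} \<union> (\<lambda>\<delta>. inst2 \<delta> (Var 0) (Var 1)) ` \<Delta>) (Var 1)"
    unfolding protoalgebraic_def by blast
  have filter: "is_filter (pp_le TYPE('u)) chain4 {x \<in> carr chain4. meet chain4 a x = a}"
    if "a \<in> carr chain4" for a
    by (rule is_filter_principal[OF inf pp_algebra_chain4 that])
  define v :: "nat \<Rightarrow> nat" where "v n = (if n = 0 then 2 else 1)" for n
  have vv: "valuation chain4 v" "valuation chain4 (\<lambda>_. 2)"
    by (auto simp: valuation_def v_def)
  have top: "eval chain4 v (inst2 \<delta> (Var 0) (Var 1)) = 3" if "\<delta> \<in> \<Delta>" for \<delta>
  proof -
    have "eval chain4 (\<lambda>_. 2) (inst2 \<delta> (Var 0) (Var 0)) \<in> {x \<in> carr chain4. meet chain4 3 x = 3}"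
      by (rule is_filterD[where L = "pp_le TYPE('u)", OF filter refl[OF that] vv(2)]) simp_all
    then have "eval chain4 (\<lambda>_. 2) \<delta> = 3"
      by (auto simp: eval_inst2)
    moreover have "merge_inner 2 = merge_inner (v n)" for n by (simp add: v_def merge_inner_def)
    ultimately have "merge_inner (eval chain4 v \<delta>) = 3"
      using merge_inner_eval_cong[OF vv(2,1), of \<delta>] by (simp add: merge_inner_def)
    then have "eval chain4 v \<delta> = 3" by (simp add: merge_inner_def split: if_splits)
    moreover have "(\<lambda>n. if n = 0 then v 0 else v 1) = v" by (auto simp: v_def)
    ultimately show ?thesis by (simp only: eval_inst2_Var)
  qed
  have "eval chain4 v ` ({Var 0} \<union> (\<lambda>\<delta>. inst2 \<delta> (Var 0) (Var 1)) ` \<Delta>)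
      \<subseteq> {x \<in> carr chain4. meet chain4 2 x = 2}"
    using top by (auto simp: v_def)
  then have "eval chain4 v (Var 1) \<in> {x \<in> carr chain4. meet chain4 2 x = 2}"
    by (intro is_filterD[where L = "pp_le TYPE('u)", OF filter mp vv(1)]) simp_all
  then show False by (simp add: v_def)
qed


section \<open>Failure of algebraizability\<close>

text \<open>The defining equations of \<open>\<delta>(x,x)\<close> follow from \<open>x \<approx> x\<close>, so that \<open>\<delta>(x,x)\<close> is a theorem. As
  \<open>\<Delta>(x,y)\<close> amounts to \<open>x \<approx> y\<close>, the defining equations of \<open>x\<close> turn into those of \<open>y\<close> in its presence.\<close>

lemma algebraizable_imp_protoalgebraic:
  assumes "algebraizable TYPE('k) L"
  shows "protoalgebraic L"
proof -
  obtain K :: "'k alg set" and \<tau> \<Delta> where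
    \<Delta>: "\<forall>\<delta>\<in>\<Delta>. vars \<delta> \<subseteq> {0, 1}"
    and iff: "\<forall>\<Gamma> \<phi>. L \<Gamma> \<phi> \<longleftrightarrow> (\<forall>e\<in>eqs_of \<tau> \<phi>. eq_conseq K (\<Union>\<gamma>\<in>\<Gamma>. eqs_of \<tau> \<gamma>) e)"
    and sound: "\<forall>e\<in>(\<Union>\<delta>\<in>\<Delta>. eqs_of \<tau> (inst2 \<delta> (Var 0) (Var 1))). eq_conseq K {(Var 0, Var 1)} e"
    and complete: "eq_conseq K (\<Union>\<delta>\<in>\<Delta>. eqs_of \<tau> (inst2 \<delta> (Var 0) (Var 1))) (Var 0, Var 1)"
    using assms[unfolded algebraizable_def Let_def] by (elim exE conjE) (rule that)
  note L = iff[THEN spec, THEN spec]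
  have "L {} (inst2 \<delta> (Var 0) (Var 0))" if "\<delta> \<in> \<Delta>" for \<delta>
    unfolding L
  proof (intro ballI)
    fix e assume "e \<in> eqs_of \<tau> (inst2 \<delta> (Var 0) (Var 0))"
    then obtain \<alpha> \<beta> where \<alpha>\<beta>: "(\<alpha>, \<beta>) \<in> \<tau>"
      and e: "e = (inst1 \<alpha> (inst2 \<delta> (Var 0) (Var 0)), inst1 \<beta> (inst2 \<delta> (Var 0) (Var 0)))"
      by (auto simp: eqs_of_def)
    have "(inst1 \<alpha> (inst2 \<delta> (Var 0) (Var 1)), inst1 \<beta> (inst2 \<delta> (Var 0) (Var 1)))
        \<in> (\<Union>\<delta>\<in>\<Delta>. eqs_of \<tau> (inst2 \<delta> (Var 0) (Var 1)))"
      using \<alpha>\<beta> that by (force simp: eqs_of_def)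
    then have c: "eq_conseq K {(Var 0, Var 1)}
        (inst1 \<alpha> (inst2 \<delta> (Var 0) (Var 1)), inst1 \<beta> (inst2 \<delta> (Var 0) (Var 1)))"
      using sound by blast
    have "eval A v (fst e) = eval A v (snd e)" if "A \<in> K" "valuation A v" for A v
    proof -
      have "valuation A (\<lambda>_. v 0)" using that(2) by (auto simp: valuation_def)
      then show ?thesis
        using c[unfolded eq_conseq_def, rule_format, of A "\<lambda>_. v 0"] that(1)
        by (simp add: e eval_inst1 eval_inst2_Var)
    qed
    then show "eq_conseq K (\<Union>\<gamma>\<in>{}. eqs_of \<tau> \<gamma>) e" by (simp add: eq_conseq_def)
  qed
  moreover have "L ({Var 0} \<union> (\<lambda>\<delta>. inst2 \<delta> (Var 0) (Var 1)) ` \<Delta>) (Var 1)"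
    unfolding L
  proof (intro ballI)
    fix e assume "e \<in> eqs_of \<tau> (Var 1)"
    then obtain \<alpha> \<beta> where \<alpha>\<beta>: "(\<alpha>, \<beta>) \<in> \<tau>" and e: "e = (inst1 \<alpha> (Var 1), inst1 \<beta> (Var 1))"
      by (auto simp: eqs_of_def)
    let ?E = "\<Union>\<gamma>\<in>{Var 0} \<union> (\<lambda>\<delta>. inst2 \<delta> (Var 0) (Var 1)) ` \<Delta>. eqs_of \<tau> \<gamma>"
    show "eq_conseq K ?E e"
      unfolding eq_conseq_def
    proof (intro ballI allI impI)
      fix A v assume A: "A \<in> K" and v: "valuation A v"
        and E: "\<forall>(\<alpha>, \<beta>)\<in>?E. eval A v \<alpha> = eval A v \<beta>"
      have "\<forall>(\<alpha>, \<beta>)\<in>(\<Union>\<delta>\<in>\<Delta>. eqs_of \<tau> (inst2 \<delta> (Var 0) (Var 1))). eval A v \<alpha> = eval A v \<beta>"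
        using E by blast
      then have "v 0 = v 1" using complete A v by (simp add: eq_conseq_def)
      have "(inst1 \<alpha> (Var 0), inst1 \<beta> (Var 0)) \<in> ?E"
        using \<alpha>\<beta> by (force simp: eqs_of_def)
      from bspec[OF E this] show "eval A v (fst e) = eval A v (snd e)"
        using \<open>v 0 = v 1\<close> by (simp add: e eval_inst1)
    qed
  qed
  ultimately show ?thesis using \<Delta> unfolding protoalgebraic_def by blast
qed

theorem proposition3p14:
  assumes "infinite (UNIV :: 'u set)"
  shows "fully_selfextensional TYPE('a) (pp_le TYPE('u)) \<and>
    \<not> protoalgebraic (pp_le TYPE('u)) \<and>
    \<not> algebraizable TYPE('k) (pp_le TYPE('u))"
proof (intro conjI)
  show "fully_selfextensional TYPE('a) (pp_le TYPE('u))"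
    unfolding fully_selfextensional_def
  proof (intro allI impI)
    fix A :: "'a alg" and C
    assume full: "full_gmodel (pp_le TYPE('u)) A C"
    then have "algebra A" by (simp add: full_gmodel_def)
    then show "congruence A (frege_relation A C)"
      unfolding frege_relation_eq_tarski[OF assms full] by (rule tarski_congruence_greatest)
  qed
  show "\<not> protoalgebraic (pp_le TYPE('u))" by (rule not_protoalgebraic[OF assms])
  then show "\<not> algebraizable TYPE('k) (pp_le TYPE('u))"
    using algebraizable_imp_protoalgebraic by blast
qed

end
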